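(* Let $q,b,z_d\in\mathbb{R}$ with $q\neq0$, $M_1>0$ and $\alpha>0$. Let $u_{\alpha g_{\alpha_{op}}}$ be the solution of $(S_\alpha)$ for $g=g_{\alpha_{op}}$, the minimizer of $J_{1\alpha}$ over $\mathbb{R}$, and for $h=x_0/n$ let $u^h_{\alpha g^h_{\alpha_{op}}}$ be the discrete solution for $g=g^h_{\alpha_{op}}$, the minimizer of $J^h_{1\alpha}$ over $\mathbb{R}$. Then there are positive constants $C_{5\alpha},C_{6\alpha}$ independent of $h$ such that, as $h\to0$ ($h=x_0/n$, $n\to\infty$), $$\text{(a)}\quad\|u_{\alpha g_{\alpha_{op}}}-u^h_{\alpha g^h_{\alpha_{op}}}\|_H=C_{5\alpha}h+o(h),\qquad\text{(b)}\quad\left\|\frac{\partial u_{\alpha g_{\alpha_{op}}}}{\partial x}-\frac{\partial u^h_{\alpha g^h_{\alpha_{op}}}}{\partial x}\right\|_H=C_{6\alpha}h+o(h).$$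
   Context: Fix $x_0,y_0>0$, $\Omega=(0,x_0)\times(0,y_0)$ and $H=L^2(\Omega)$ with its standard norm. For constants $g,q,b\in\mathbb{R}$ and $\alpha>0$, system $(S_\alpha)$: $-\Delta u=g$ in $\Omega$, $-\partial u/\partial n=\alpha(u-b)$ on $\{0\}\times(0,y_0]$, $-\partial u/\partial n=q$ on $\{x_0\}\times(0,y_0]$, $-\partial u/\partial n=0$ on $[0,x_0]\times\{0,y_0\}$, has solution $u_{\alpha g}(x,y)=-\tfrac12gx^2+(gx_0-q)x+\tfrac1\alpha(gx_0-q)+b$. For an integer $n\ge1$, $h=x_0/n$, $x_i=(i-1)h$, its discrete (finite-difference, piecewise linear) approximation is $u^h_{\alpha g}(x,y)=(gx_0-q-hgi)x+b+\tfrac{gx_0-q}\alpha-\tfrac{gh}\alpha+\tfrac{i^2-i}2gh^2$ for $x\in[x_i,x_{i+1}]$, $y\in[0,y_0]$, $i=1,\dots,n$ (its $x$-derivative is piecewise constant, defined a.e.). For fixed $q,b,z_d\in\mathbb{R}$ and $M_1>0$ the cost functions on $\mathbb{R}$ are $J_{1\alpha}(g)=\tfrac12\|u_{\alpha g}-z_d\|_H^2+\tfrac{M_1}2\|g\|_H^2$ and $J^h_{1\alpha}(g)=\tfrac12\|u^h_{\alpha g}-z_d\|_H^2+\tfrac{M_1}2\|g\|_H^2$, where constants are viewed as constant functions on $\Omega$ (so $\|g\|_H^2=x_0y_0g^2$). The minimizers are $g_{\alpha_{op}}=\frac q{3x_0}\frac{A_{1\alpha}}{A_{4\alpha}}$ and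 $g^h_{\alpha_{op}}=\frac q{3x_0}\frac{A_{1\alpha}+\frac h{x_0}A_{2\alpha}+\frac{h^2}{x_0^2}A_{3\alpha}}{A_{4\alpha}+A_{5\alpha}(h)}$, where $A_{1\alpha}=\tfrac58-\tfrac{b-z_d}{qx_0}+\tfrac1{\alpha x_0}\left(\tfrac52+\tfrac3{\alpha x_0}-\tfrac{3(b-z_d)}{qx_0}\right)$, $A_{2\alpha}=\tfrac{3(b-z_d)}{4qx_0}-\tfrac12+\tfrac1{\alpha x_0}\left(-\tfrac94-\tfrac3{\alpha x_0}+\tfrac{3(b-z_d)}{qx_0}\right)$, $A_{3\alpha}=\tfrac{b-z_d}{4qx_0}-\tfrac18-\tfrac1{4\alpha x_0}$, $A_{4\alpha}=\tfrac2{15}+\tfrac{M_1}{x_0^4}+\tfrac1{\alpha x_0}\left(\tfrac23+\tfrac1{\alpha x_0}\right)$, $A_{5\alpha}(h)=\tfrac h{12x_0}\left(\tfrac{h^3}{15x_0^3}+\tfrac{h^2}{2x_0^2}+\tfrac h{3x_0}-\tfrac52\right)+\tfrac h{\alpha x_0^2}\left(-\tfrac76+\tfrac h{3x_0}+\tfrac{h^2}{6x_0^2}+\tfrac1{\alpha x_0}\left(-2+\tfrac h{x_0}\right)\right)$. *)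

theory Defs
  imports "HOL-Analysis.Analysis" "HOL-Library.Landau_Symbols"
begin

definition Omega :: "real \<Rightarrow> real \<Rightarrow> (real \<times> real) set" where
  "Omega x0 y0 = {0<..<x0} \<times> {0<..<y0}"

definition H_norm :: "real \<Rightarrow> real \<Rightarrow> (real \<times> real \<Rightarrow> real) \<Rightarrow> real" where
  "H_norm x0 y0 f = sqrt (LINT p:Omega x0 y0|lborel. (f p)\<^sup>2)"

text \<open>For a piecewise linear function in \<open>x\<close>, the value of \<open>deriv\<close> is unspecified on the grid
  lines, which form a null set.\<close>

definition partial_x :: "(real \<times> real \<Rightarrow> real) \<Rightarrow> real \<times> real \<Rightarrow> real" where
  "partial_x f = (\<lambda>(x, y). deriv (\<lambda>s. f (s, y)) x)"

text \<open>The boundary value problem. The outward normal derivative is minus the partial derivative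
  in \<open>x\<close> on the side \<open>x = 0\<close>, minus the one in \<open>y\<close> on the side \<open>y = 0\<close>, and the respective
  partial derivative itself on the opposite sides; on the boundary the derivatives are one-sided.\<close>

definition solves_S ::
  "real \<Rightarrow> real \<Rightarrow> real \<Rightarrow> real \<Rightarrow> real \<Rightarrow> real \<Rightarrow> (real \<times> real \<Rightarrow> real) \<Rightarrow> bool" where
  "solves_S x0 y0 q b \<alpha> g v \<longleftrightarrow>
    (\<exists>vx vy.
      (\<forall>x\<in>{0..x0}. \<forall>y\<in>{0..y0}.
         ((\<lambda>s. v (s, y)) has_real_derivative vx x y) (at x within {0..x0}) \<and>
         ((\<lambda>t. v (x, t)) has_real_derivative vy x y) (at y within {0..y0})) \<and>
      (\<forall>(x, y)\<in>Omega x0 y0. \<exists>vxx vyy.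
         ((\<lambda>s. vx s y) has_real_derivative vxx) (at x) \<and>
         ((\<lambda>t. vy x t) has_real_derivative vyy) (at y) \<and>
         - (vxx + vyy) = g) \<and>
      (\<forall>y\<in>{0<..y0}. vx 0 y = \<alpha> * (v (0, y) - b)) \<and>
      (\<forall>y\<in>{0<..y0}. - vx x0 y = q) \<and>
      (\<forall>x\<in>{0..x0}. vy x 0 = 0 \<and> - vy x y0 = 0))"

definition u_sol :: "real \<Rightarrow> real \<Rightarrow> real \<Rightarrow> real \<Rightarrow> real \<Rightarrow> real \<times> real \<Rightarrow> real" where
  "u_sol x0 q b \<alpha> g = (\<lambda>(x, y).
     - (1 / 2) * g * x\<^sup>2 + (g * x0 - q) * x + (1 / \<alpha>) * (g * x0 - q) + b)"

lemma u_sol_solves_S: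
  assumes "\<alpha> > 0"
  shows "solves_S x0 y0 q b \<alpha> g (u_sol x0 q b \<alpha> g)"
  unfolding solves_S_def u_sol_def
proof (rule exI[of _ "\<lambda>x y. - g * x + (g * x0 - q)"], rule exI[of _ "\<lambda>x y. 0"],
    intro conjI ballI)
  fix p assume "p \<in> Omega x0 y0"
  show "case p of (x, y) \<Rightarrow> \<exists>vxx vyy.
      ((\<lambda>s. - g * s + (g * x0 - q)) has_real_derivative vxx) (at x) \<and>
      ((\<lambda>t. 0) has_real_derivative vyy) (at y) \<and> - (vxx + vyy) = g"
    unfolding case_prod_beta
    by (rule exI[of _ "- g"], rule exI[of _ 0]) (auto intro!: derivative_eq_intros)
qed (use assms in \<open>auto intro!: derivative_eq_intros simp: field_simps\<close>)

text \<open>The discrete solution with mesh size \<open>h = x0 / n\<close>. The formula on the \<open>i\<close>-th cell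
  \<open>[(i - 1) * h, i * h]\<close> is selected through the floor of \<open>x / h\<close>; the formulas of adjacent cells
  agree at the common node, so the choice made there is immaterial.\<close>

definition u_cell ::
  "real \<Rightarrow> real \<Rightarrow> real \<Rightarrow> real \<Rightarrow> real \<Rightarrow> real \<Rightarrow> real \<Rightarrow> real \<Rightarrow> real" where
  "u_cell x0 q b \<alpha> h g i x =
     (g * x0 - q - h * g * i) * x + b + (g * x0 - q) / \<alpha> - g * h / \<alpha> + (i\<^sup>2 - i) / 2 * g * h\<^sup>2"

definition u_disc ::
  "real \<Rightarrow> real \<Rightarrow> real \<Rightarrow> real \<Rightarrow> real \<Rightarrow> real \<Rightarrow> real \<times> real \<Rightarrow> real" where
  "u_disc x0 q b \<alpha> h g = (\<lambda>(x, y). u_cell x0 q b \<alpha> h g (of_int \<lfloor>x / h\<rfloor> + 1) x)"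

lemma u_disc_on_cell:
  fixes i n :: nat
  assumes "x0 > 0" and "i \<in> {1..n}" and h: "h = x0 / real n"
    and x: "x \<in> {(real i - 1) * h .. real i * h}"
  shows "u_disc x0 q b \<alpha> h g (x, y) = u_cell x0 q b \<alpha> h g (real i) x"
proof -
  have hpos: "h > 0" using assms by auto
  show ?thesis
  proof (cases "x = real i * h")
    case True
    then have "\<lfloor>x / h\<rfloor> = int i" using hpos by simp
    then show ?thesis
      by (simp add: u_disc_def u_cell_def True field_simps power2_eq_square)
  next
    case False
    then have "real i - 1 \<le> x / h" "x / h < real i"
      using x hpos by (auto simp: field_simps)
    then have "\<lfloor>x / h\<rfloor> = int i - 1" by linarith
    then show ?thesis by (simp add: u_disc_def)
  qed
qed

definition J_cost ::
  "real \<Rightarrow> real \<Rightarrow> real \<Rightarrow> real \<Rightarrow> real \<Rightarrow> real \<Rightarrow> real \<Rightarrow> real \<Rightarrow> real" where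
  "J_cost x0 y0 q b zd M1 \<alpha> g =
     1 / 2 * (H_norm x0 y0 (\<lambda>p. u_sol x0 q b \<alpha> g p - zd))\<^sup>2
     + M1 / 2 * (H_norm x0 y0 (\<lambda>p. g))\<^sup>2"

definition J_disc ::
  "real \<Rightarrow> real \<Rightarrow> real \<Rightarrow> real \<Rightarrow> real \<Rightarrow> real \<Rightarrow> real \<Rightarrow> real \<Rightarrow> real \<Rightarrow> real" where
  "J_disc x0 y0 q b zd M1 \<alpha> h g =
     1 / 2 * (H_norm x0 y0 (\<lambda>p. u_disc x0 q b \<alpha> h g p - zd))\<^sup>2
     + M1 / 2 * (H_norm x0 y0 (\<lambda>p. g))\<^sup>2"

definition g_op :: "real \<Rightarrow> real \<Rightarrow> real \<Rightarrow> real \<Rightarrow> real \<Rightarrow> real \<Rightarrow> real \<Rightarrow> real" where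
  "g_op x0 y0 q b zd M1 \<alpha> = arg_min_on (J_cost x0 y0 q b zd M1 \<alpha>) UNIV"

definition g_disc_op :: "real \<Rightarrow> real \<Rightarrow> real \<Rightarrow> real \<Rightarrow> real \<Rightarrow> real \<Rightarrow> real \<Rightarrow> real \<Rightarrow> real" where
  "g_disc_op x0 y0 q b zd M1 \<alpha> h = arg_min_on (J_disc x0 y0 q b zd M1 \<alpha> h) UNIV"

end

theory Submission
  imports Defs
begin

text \<open>
  Both states depend on \<open>x\<close> alone and are affine in the control. With the source profile
  \<open>\<phi> x = - x\<^sup>2 / 2 + x0 * x + x0 / \<alpha>\<close> and the linear offset
  \<open>\<psi> x = b - q / \<alpha> - q * x\<close> the continuous state is \<open>g * \<phi> + \<psi>\<close>. Writing
  \<open>x = h * (i + t)\<close> with \<open>i\<close> an integer and \<open>0 \<le> t < 1\<close>, the discrete state is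
  \<open>g * (\<phi> - h * \<kappa>\<^sub>h) + \<psi>\<close> exactly, where
  \<open>\<kappa>\<^sub>h x = 1 / \<alpha> + x / 2 + h * t * (1 - t) / 2\<close> converges uniformly to
  \<open>\<kappa> x = 1 / \<alpha> + x / 2\<close>. So the scheme has a genuine first-order error with known profile.

  The costs are quadratic in \<open>g\<close>, hence the optimal controls are quotients of moments of
  \<open>\<phi>\<close>, \<open>\<kappa>\<^sub>h\<close> and \<open>\<psi>\<close>, where from now on \<open>b\<close> is replaced by \<open>b - zd\<close> in
  \<open>\<psi>\<close>; since these moments converge, the control error is \<open>\<delta> * h + o(h)\<close> for an
  explicit \<open>\<delta>\<close> (\<open>optimum_expansion\<close>). The state error divided by \<open>h\<close> then tends to
  \<open>\<delta> * \<phi> + g * \<kappa>\<close> in norm. The error of the derivative divided by \<open>h\<close> behaves like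
  \<open>\<delta> * (x0 - x) + g * (1 - t)\<close>; the sawtooth \<open>1 - t\<close> oscillates faster and faster, so this
  has no pointwise limit, but its norm has a closed form (\<open>sawtooth_strip_ip\<close>) and converges,
  with the mean \<open>1/2\<close> of the sawtooth in the mixed term and its mean square \<open>1/3\<close> in the pure
  one.

  Both limiting squared norms are positive definite quadratic forms in \<open>(\<delta>, g)\<close>, so it remains
  to exclude \<open>\<delta> = g = 0\<close>. If \<open>g = 0\<close>, then \<open>\<psi>\<close> is orthogonal to \<open>\<phi>\<close>, and
  if moreover \<open>\<delta> = 0\<close>, also to \<open>\<kappa>\<close>. For a linear function \<open>\<psi>\<close> of slope \<open>- q\<close> these
  are two homogeneous linear equations for its two coefficients, with a determinant that is
  a nonzero multiple of \<open>x0 ^ 6\<close>; thus \<open>q = 0\<close>, contrary to assumption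
  (\<open>offset_not_orthogonal\<close>).
\<close>

section \<open>Bounded functions on an interval and their inner product\<close>

definition strip_ip :: "real \<Rightarrow> (real \<Rightarrow> real) \<Rightarrow> (real \<Rightarrow> real) \<Rightarrow> real" where
  "strip_ip x0 f k = (LINT x:{0<..<x0}|lborel. f x * k x)"

text \<open>This class contains both the polynomials and the functions of the fractional part of
  \<open>x / h\<close> that occur below, it is closed under sums and products, and all its members are
  integrable; this makes the inner product bilinear without further side conditions.\<close>
definition bdd_meas :: "real \<Rightarrow> (real \<Rightarrow> real) \<Rightarrow> bool" where
  "bdd_meas x0 f \<longleftrightarrow> f \<in> borel_measurable borel \<and> (\<exists>B. \<forall>x\<in>{0<..<x0}. \<bar>f x\<bar> \<le> B)"

lemma bdd_meas_continuous:
  assumes "continuous_on UNIV f"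
  shows "bdd_meas x0 f"
proof -
  have "compact (f ` {0..x0})"
    by (rule compact_continuous_image) (auto intro: continuous_on_subset[OF assms])
  then obtain B where "\<forall>y\<in>f ` {0..x0}. norm y \<le> B"
    using compact_imp_bounded bounded_iff by blast
  then have "\<forall>x\<in>{0<..<x0}. \<bar>f x\<bar> \<le> B" by auto
  then show ?thesis
    using borel_measurable_continuous_onI[OF assms] by (auto simp: bdd_meas_def)
qed

lemma bdd_meas_mult:
  assumes "bdd_meas x0 f" "bdd_meas x0 k"
  shows "bdd_meas x0 (\<lambda>x. f x * k x)"
proof -
  obtain A B where A: "\<forall>x\<in>{0<..<x0}. \<bar>f x\<bar> \<le> A" and B: "\<forall>x\<in>{0<..<x0}. \<bar>k x\<bar> \<le> B"
    using assms by (auto simp: bdd_meas_def)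
  have "\<bar>f x * k x\<bar> \<le> A * B" if "x \<in> {0<..<x0}" for x
    unfolding abs_mult using A B that
    by (meson abs_ge_zero mult_mono order_trans)
  then have "\<forall>x\<in>{0<..<x0}. \<bar>f x * k x\<bar> \<le> A * B" by blast
  moreover have "(\<lambda>x. f x * k x) \<in> borel_measurable borel"
    using assms by (auto simp: bdd_meas_def)
  ultimately show ?thesis unfolding bdd_meas_def by blast
qed

lemma bdd_meas_add:
  assumes "bdd_meas x0 f" "bdd_meas x0 k"
  shows "bdd_meas x0 (\<lambda>x. f x + k x)"
proof -
  obtain A B where A: "\<forall>x\<in>{0<..<x0}. \<bar>f x\<bar> \<le> A" and B: "\<forall>x\<in>{0<..<x0}. \<bar>k x\<bar> \<le> B"
    using assms by (auto simp: bdd_meas_def)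
  have "\<bar>f x + k x\<bar> \<le> A + B" if "x \<in> {0<..<x0}" for x
    using A B that by (meson abs_triangle_ineq add_mono order_trans)
  then have "\<forall>x\<in>{0<..<x0}. \<bar>f x + k x\<bar> \<le> A + B" by blast
  moreover have "(\<lambda>x. f x + k x) \<in> borel_measurable borel"
    using assms by (auto simp: bdd_meas_def)
  ultimately show ?thesis unfolding bdd_meas_def by blast
qed

lemma bdd_meas_const: "bdd_meas x0 (\<lambda>x. c)"
  by (rule bdd_meas_continuous) simp

lemma bdd_meas_integrable:
  assumes "bdd_meas x0 f"
  shows "set_integrable lborel {0<..<x0} f"
proof -
  obtain B where B: "\<forall>x\<in>{0<..<x0}. \<bar>f x\<bar> \<le> B"
    using assms by (auto simp: bdd_meas_def)
  have "emeasure lborel {0<..<x0} < \<infinity>"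
    by (cases "0 \<le> x0") auto
  then show ?thesis
    unfolding set_integrable_def using assms B
    by (intro integrableI_bounded_set_indicator[where B = B]) (auto simp: bdd_meas_def)
qed

lemma strip_integral_eq_integral:
  assumes "bdd_meas x0 f"
  shows "(LINT x:{0<..<x0}|lborel. f x) = integral {0..x0} f"
  using set_borel_integral_eq_integral(2)[OF bdd_meas_integrable[OF assms]]
  by (simp add: integral_open_interval_real)

lemma strip_ip_commute: "strip_ip x0 f k = strip_ip x0 k f"
  by (simp add: strip_ip_def mult.commute)

lemma strip_ip_linear:
  assumes "bdd_meas x0 f" "bdd_meas x0 k" "bdd_meas x0 w"
  shows "strip_ip x0 (\<lambda>x. a * f x + c * k x) w = a * strip_ip x0 f w + c * strip_ip x0 k w"
proof -
  have i: "set_integrable lborel {0<..<x0} (\<lambda>x. a * (f x * w x))"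
    "set_integrable lborel {0<..<x0} (\<lambda>x. c * (k x * w x))"
    using assms by (auto intro!: bdd_meas_integrable bdd_meas_mult bdd_meas_const)
  have "strip_ip x0 (\<lambda>x. a * f x + c * k x) w
      = (LINT x:{0<..<x0}|lborel. a * (f x * w x) + c * (k x * w x))"
    by (simp add: strip_ip_def algebra_simps)
  also have "\<dots> = a * strip_ip x0 f w + c * strip_ip x0 k w"
    using i by (simp add: set_integral_add strip_ip_def)
  finally show ?thesis .
qed

lemma strip_ip_square:
  assumes "bdd_meas x0 f" "bdd_meas x0 k"
  shows "strip_ip x0 (\<lambda>x. a * f x + c * k x) (\<lambda>x. a * f x + c * k x)
    = a\<^sup>2 * strip_ip x0 f f + 2 * a * c * strip_ip x0 f k + c\<^sup>2 * strip_ip x0 k k"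
proof -
  have s: "bdd_meas x0 (\<lambda>x. a * f x + c * k x)"
    by (intro bdd_meas_add bdd_meas_mult bdd_meas_const assms)
  have "strip_ip x0 w (\<lambda>x. a * f x + c * k x) = a * strip_ip x0 f w + c * strip_ip x0 k w"
    if "bdd_meas x0 w" for w
    using strip_ip_linear[OF assms that] strip_ip_commute by metis
  then show ?thesis
    using strip_ip_linear[OF assms s] assms strip_ip_commute[of x0 k f]
    by (simp add: algebra_simps power2_eq_square)
qed

lemma strip_ip_nonneg: "0 \<le> strip_ip x0 f f"
  unfolding strip_ip_def set_lebesgue_integral_def by (rule Bochner_Integration.integral_nonneg) auto

text \<open>A continuous nonnegative function with zero integral vanishes identically, at the end
  points by continuity.\<close>
lemma strip_ip_eq_0D:
  assumes "continuous_on UNIV f" "strip_ip x0 f f = 0" "x \<in> {0..x0}" "0 < x0"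
  shows "f x = 0"
proof -
  have c: "continuous_on UNIV (\<lambda>x. f x * f x)" by (intro continuous_intros assms)
  have "integral {0..x0} (\<lambda>x. f x * f x) = 0"
    using strip_integral_eq_integral[OF bdd_meas_continuous[OF c]] assms(2)
    by (simp add: strip_ip_def)
  moreover have "(\<lambda>x. f x * f x) integrable_on {0..x0}"
    by (rule integrable_continuous_real) (rule continuous_on_subset[OF c], simp)
  ultimately have "((\<lambda>x. f x * f x) has_integral 0) (cbox 0 x0)"
    by (metis cbox_interval has_integral_integral)
  then have "f x * f x = 0"
    using assms by (intro has_integral_0_cbox_imp_0[of 0 x0 "\<lambda>x. f x * f x"])
      (auto intro: continuous_on_subset[OF c])
  then show ?thesis by simp
qed

text \<open>Dominated convergence, the dominating function being the constant \<open>A * B\<close>.\<close>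
lemma strip_ip_tendsto:
  assumes m: "\<And>n. f n \<in> borel_measurable borel" "\<And>n. k n \<in> borel_measurable borel"
    "F \<in> borel_measurable borel" "K \<in> borel_measurable borel"
    and B: "\<And>n x. x \<in> {0<..<x0} \<Longrightarrow> \<bar>f n x\<bar> \<le> A" "\<And>n x. x \<in> {0<..<x0} \<Longrightarrow> \<bar>k n x\<bar> \<le> B"
    and l: "\<And>x. x \<in> {0<..<x0} \<Longrightarrow> (\<lambda>n. f n x) \<longlonglongrightarrow> F x"
      "\<And>x. x \<in> {0<..<x0} \<Longrightarrow> (\<lambda>n. k n x) \<longlonglongrightarrow> K x"
  shows "(\<lambda>n. strip_ip x0 (f n) (k n)) \<longlonglongrightarrow> strip_ip x0 F K"
  unfolding strip_ip_def set_lebesgue_integral_def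
proof (rule integral_dominated_convergence)
  show "integrable lborel (\<lambda>x. indicator {0<..<x0} x *\<^sub>R (A * B))"
    using bdd_meas_integrable[OF bdd_meas_const] unfolding set_integrable_def .
  show "AE x in lborel. norm (indicator {0<..<x0} x *\<^sub>R (f n x * k n x))
      \<le> indicator {0<..<x0} x *\<^sub>R (A * B)" for n
    using B by (intro AE_I2) (auto simp: indicator_def abs_mult intro!: mult_mono intro: order_trans[OF abs_ge_zero])
  show "AE x in lborel. (\<lambda>n. indicator {0<..<x0} x *\<^sub>R (f n x * k n x))
      \<longlonglongrightarrow> indicator {0<..<x0} x *\<^sub>R (F x * K x)"
    by (intro AE_I2) (auto simp: indicator_def intro!: tendsto_mult l)
qed (use m in measurable)

text \<open>Fubini's theorem for functions of the first coordinate. It is applied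
  to the nonnegative integral and so covers every measurable \<open>k\<close>, in particular the
  derivatives, whose values on the grid lines are unknown.\<close>
lemma H_norm_of_x:
  assumes [measurable]: "k \<in> borel_measurable borel" and "y0 > 0"
  shows "H_norm x0 y0 (\<lambda>p. k (fst p)) = sqrt (y0 * strip_ip x0 k k)"
proof -
  have "(LINT p:Omega x0 y0|lborel. (k (fst p))\<^sup>2)
      = enn2real (\<integral>\<^sup>+p. ennreal (indicator (Omega x0 y0) p * (k (fst p))\<^sup>2)
          \<partial>(lborel \<Otimes>\<^sub>M lborel))"
    unfolding set_lebesgue_integral_def lborel_prod[symmetric] Omega_def
    by (subst integral_eq_nn_integral) auto
  also have "(\<integral>\<^sup>+p. ennreal (indicator (Omega x0 y0) p * (k (fst p))\<^sup>2) \<partial>(lborel \<Otimes>\<^sub>M lborel))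
      = (\<integral>\<^sup>+x. \<integral>\<^sup>+y. ennreal (indicator (Omega x0 y0) (x, y) * (k x)\<^sup>2) \<partial>lborel \<partial>lborel)"
    unfolding Omega_def by (subst lborel.nn_integral_fst[symmetric]) auto
  also have "\<dots> = (\<integral>\<^sup>+x. \<integral>\<^sup>+y. ennreal (indicator {0<..<x0} x * (k x)\<^sup>2) * indicator {0<..<y0} y
      \<partial>lborel \<partial>lborel)"
    by (intro nn_integral_cong) (auto simp: Omega_def indicator_def)
  also have "\<dots> = (\<integral>\<^sup>+x. ennreal (indicator {0<..<x0} x * (k x)\<^sup>2) \<partial>lborel) * ennreal y0"
    using assms(2) by (simp add: nn_integral_cmult nn_integral_multc)
  also have "enn2real \<dots> = y0 * strip_ip x0 k k"
    unfolding strip_ip_def set_lebesgue_integral_def enn2real_mult using assms(2)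
    by (subst integral_eq_nn_integral) (auto simp: power2_eq_square)
  finally show ?thesis by (simp add: H_norm_def)
qed

section \<open>The optimal control for a state that is affine in the control\<close>

lemma arg_min_quadratic:
  fixes a c d :: real
  assumes "a > 0" and J: "\<And>g. J g = a * g\<^sup>2 + 2 * c * g + d"
  shows "arg_min_on J UNIV = - c / a"
proof -
  \<comment> \<open>Completing the square.\<close>
  have sq: "J g = J (- c / a) + a * (g + c / a)\<^sup>2" for g
    using assms(1) by (simp add: J field_simps power2_eq_square)
  have "is_arg_min J (\<lambda>x. True) g \<longleftrightarrow> g = - c / a" for g
  proof
    assume "is_arg_min J (\<lambda>x. True) g"
    then have "J g \<le> J (- c / a)" by (simp add: is_arg_min_linorder)
    then have "a * (g + c / a)\<^sup>2 \<le> 0" using sq[of g] by simp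
    then have "g + c / a = 0" using assms(1)
      by (metis mult_le_0_iff not_less power2_less_eq_zero_iff)
    then show "g = - c / a" by simp
  next
    assume "g = - c / a"
    then have "J g \<le> J g'" for g' using sq[of g'] assms(1) by simp
    then show "is_arg_min J (\<lambda>x. True) g" by (simp add: is_arg_min_linorder)
  qed
  then show ?thesis by (simp add: arg_min_on_def arg_min_def)
qed

text \<open>The continuous and the discrete problem are both of this form, with the same \<open>\<psi>\<close> and
  different \<open>\<phi>\<close>; the cost is a quadratic polynomial in \<open>g\<close> whose coefficients are moments.\<close>
lemma arg_min_affine_state:
  assumes "bdd_meas x0 \<phi>" "bdd_meas x0 \<psi>" "x0 > 0" "y0 > 0" "M1 > 0"
  shows "arg_min_on (\<lambda>g. 1 / 2 * (H_norm x0 y0 (\<lambda>p. g * \<phi> (fst p) + \<psi> (fst p)))\<^sup>2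
      + M1 / 2 * (H_norm x0 y0 (\<lambda>p. g))\<^sup>2) UNIV
    = - strip_ip x0 \<phi> \<psi> / (strip_ip x0 \<phi> \<phi> + M1 * x0)"
proof -
  define D where "D = strip_ip x0 \<phi> \<phi> + M1 * x0"
  have D: "D > 0" using strip_ip_nonneg[of x0 \<phi>] assms by (simp add: D_def add_nonneg_pos)
  have m: "(\<lambda>x. g * \<phi> x + \<psi> x) \<in> borel_measurable borel" for g
    using assms by (auto simp: bdd_meas_def)
  have s: "(H_norm x0 y0 (\<lambda>p. g * \<phi> (fst p) + \<psi> (fst p)))\<^sup>2
     = y0 * (g\<^sup>2 * strip_ip x0 \<phi> \<phi> + 2 * g * strip_ip x0 \<phi> \<psi> + strip_ip x0 \<psi> \<psi>)" for g
    using H_norm_of_x[OF m[of g] assms(4), of x0] strip_ip_square[OF assms(1,2), of g 1] assms(4)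
    using strip_ip_nonneg[of x0 "\<lambda>x. g * \<phi> x + \<psi> x"] by simp
  have c: "(H_norm x0 y0 (\<lambda>p. g))\<^sup>2 = y0 * (x0 * g\<^sup>2)" for g
  proof -
    have "strip_ip x0 (\<lambda>_. g) (\<lambda>_. g) = x0 * g\<^sup>2"
      using assms by (simp add: strip_ip_def set_lebesgue_integral_def power2_eq_square)
    then show ?thesis using H_norm_of_x[of "\<lambda>_. g" y0 x0] assms by simp
  qed
  have "arg_min_on (\<lambda>g. 1 / 2 * (H_norm x0 y0 (\<lambda>p. g * \<phi> (fst p) + \<psi> (fst p)))\<^sup>2
      + M1 / 2 * (H_norm x0 y0 (\<lambda>p. g))\<^sup>2) UNIV
    = - (y0 / 2 * strip_ip x0 \<phi> \<psi>) / (y0 / 2 * D)"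
    by (rule arg_min_quadratic[where d = "y0 / 2 * strip_ip x0 \<psi> \<psi>"])
      (use assms D in simp, simp only: s c D_def, simp add: algebra_simps)
  then show ?thesis using assms D by (simp add: D_def)
qed

text \<open>The quotient \<open>gn\<close> is what \<open>arg_min_affine_state\<close> gives when \<open>\<phi>\<close> is replaced by
  \<open>\<phi> - h * \<kappa>\<close>; then \<open>k\<close>, \<open>e\<close> and \<open>f\<close> are the inner products of \<open>\<kappa>\<close> with
  \<open>\<psi>\<close>, \<open>\<phi>\<close> and \<open>\<kappa>\<close>. Bringing the difference to a common denominator, a factor
  \<open>h\<close> splits off, and mere convergence of the moments gives the first-order term.\<close>
lemma optimum_expansion:
  fixes h k e f :: "nat \<Rightarrow> real"
  assumes "D > 0" and h: "h \<longlonglongrightarrow> 0" "\<forall>\<^sub>F n in sequentially. h n \<noteq> 0"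
    and l: "k \<longlonglongrightarrow> kl" "e \<longlonglongrightarrow> el" "f \<longlonglongrightarrow> fl"
    and g: "\<forall>\<^sub>F n in sequentially. gn n = - (N - h n * k n) / (D - 2 * h n * e n + (h n)\<^sup>2 * f n)"
  shows "(\<lambda>n. (- N / D - gn n) / h n) \<longlonglongrightarrow> (2 * N * el - kl * D) / D\<^sup>2"
proof -
  define Dn where "Dn n = D - 2 * h n * e n + (h n)\<^sup>2 * f n" for n
  have Dn: "Dn \<longlonglongrightarrow> D - 2 * 0 * el + 0\<^sup>2 * fl"
    unfolding Dn_def by (intro tendsto_intros h l)
  then have ev: "\<forall>\<^sub>F n in sequentially. Dn n > 0"
    using order_tendstoD(1)[OF Dn, of 0] assms(1) by simp
  have "(\<lambda>n. (2 * N * e n - N * h n * f n - k n * D) / (D * Dn n))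
      \<longlonglongrightarrow> (2 * N * el - N * 0 * fl - kl * D) / (D * (D - 2 * 0 * el + 0\<^sup>2 * fl))"
    by (intro tendsto_intros h l Dn) (use assms(1) in auto)
  then have "(\<lambda>n. (2 * N * e n - N * h n * f n - k n * D) / (D * Dn n))
      \<longlonglongrightarrow> (2 * N * el - kl * D) / D\<^sup>2"
    by (simp add: power2_eq_square)
  moreover have "\<forall>\<^sub>F n in sequentially. (- N / D - gn n) / h n
      = (2 * N * e n - N * h n * f n - k n * D) / (D * Dn n)"
    using ev h(2) g
  proof eventually_elim
    case (elim n)
    have "gn n = - (N - h n * k n) / Dn n" using elim by (simp add: Dn_def)
    then have "- N / D - gn n = (D * (N - h n * k n) - N * Dn n) / (D * Dn n)"
      using elim(1) assms(1) by (simp only:) (simp add: field_simps)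
    also have "D * (N - h n * k n) - N * Dn n = h n * (2 * N * e n - N * h n * f n - k n * D)"
      by (simp add: Dn_def algebra_simps power2_eq_square)
    finally show ?case using elim(2) by simp
  qed
  ultimately show ?thesis by (simp add: filterlim_cong)
qed

section \<open>The states as affine functions of the control\<close>

definition source_profile :: "real \<Rightarrow> real \<Rightarrow> real \<Rightarrow> real" where
  "source_profile x0 \<alpha> x = - x\<^sup>2 / 2 + x0 * x + x0 / \<alpha>"

text \<open>The parameter \<open>c\<close> is \<open>b\<close> for the state itself and \<open>b - zd\<close> for its deviation from the
  target.\<close>
definition state_offset :: "real \<Rightarrow> real \<Rightarrow> real \<Rightarrow> real \<Rightarrow> real" where
  "state_offset q c \<alpha> x = c - q / \<alpha> - q * x"

text \<open>The error of the discrete solution for the control \<open>1\<close>, divided by \<open>h\<close>. Since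
  division by \<open>0\<close> yields \<open>0\<close>, the value at \<open>h = 0\<close> is the limit profile.\<close>
definition mesh_profile :: "real \<Rightarrow> real \<Rightarrow> real \<Rightarrow> real" where
  "mesh_profile \<alpha> h x = 1 / \<alpha> + x / 2 + h / 2 * (frac (x / h) * (1 - frac (x / h)))"

lemma mesh_profile_0: "mesh_profile \<alpha> 0 = (\<lambda>x. 1 / \<alpha> + x / 2)"
  by (simp add: mesh_profile_def fun_eq_iff)

lemma u_sol_affine:
  "u_sol x0 q c \<alpha> g p = g * source_profile x0 \<alpha> (fst p) + state_offset q c \<alpha> (fst p)"
  by (simp add: u_sol_def source_profile_def state_offset_def case_prod_beta algebra_simps
      diff_divide_distrib)

lemma u_disc_affine:
  assumes "h \<noteq> 0"
  shows "u_disc x0 q c \<alpha> h g p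
    = g * (source_profile x0 \<alpha> (fst p) - h * mesh_profile \<alpha> h (fst p))
      + state_offset q c \<alpha> (fst p)"
proof -
  define x where "x = fst p"
  define i t where "i = real_of_int \<lfloor>x / h\<rfloor>" and "t = frac (x / h)"
  have "x / h = i + t" by (simp add: i_def t_def frac_def)
  then have x: "x = h * (i + t)" using assms by (simp add: field_simps)
  have "u_disc x0 q c \<alpha> h g p = u_cell x0 q c \<alpha> h g (i + 1) x"
    by (simp add: u_disc_def case_prod_beta x_def i_def)
  also have "\<dots> = g * (source_profile x0 \<alpha> x - h * (1 / \<alpha> + x / 2 + h / 2 * (t * (1 - t))))
      + state_offset q c \<alpha> x"
    unfolding u_cell_def source_profile_def state_offset_def x
    by (simp add: algebra_simps power2_eq_square diff_divide_distrib add_divide_distrib)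
  finally show ?thesis by (simp add: mesh_profile_def x_def t_def)
qed

lemma bdd_meas_frac: "bdd_meas x0 (\<lambda>x. frac (x / h))"
proof -
  have "\<bar>frac (x / h)\<bar> \<le> 1" for x :: real
    using frac_ge_0[of "x / h"] frac_lt_1[of "x / h"] by linarith
  moreover have "(\<lambda>x. frac (x / h)) \<in> borel_measurable borel"
    unfolding frac_def by measurable
  ultimately show ?thesis by (auto simp: bdd_meas_def)
qed

lemma mesh_profile_bound:
  assumes "x \<in> {0<..<x0}" "\<bar>h\<bar> \<le> x0" "\<alpha> > 0"
  shows "\<bar>mesh_profile \<alpha> h x\<bar> \<le> 1 / \<alpha> + x0"
    and "\<bar>mesh_profile \<alpha> h x - mesh_profile \<alpha> 0 x\<bar> \<le> \<bar>h\<bar>"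
proof -
  define t where "t = frac (x / h)"
  have t: "0 \<le> t" "t < 1" by (simp_all add: t_def frac_lt_1)
  then have s: "0 \<le> t * (1 - t)" "t * (1 - t) \<le> 1" by (simp_all add: mult_le_one)
  then have "\<bar>h / 2 * (t * (1 - t))\<bar> \<le> \<bar>h\<bar> / 2 * 1"
    unfolding abs_mult by (intro mult_mono) auto
  then have b: "\<bar>h / 2 * (t * (1 - t))\<bar> \<le> \<bar>h\<bar> / 2" by simp
  have p: "1 / \<alpha> > 0" using assms by simp
  have eq: "mesh_profile \<alpha> h x = 1 / \<alpha> + x / 2 + h / 2 * (t * (1 - t))"
    by (simp add: mesh_profile_def t_def)
  show "\<bar>mesh_profile \<alpha> h x\<bar> \<le> 1 / \<alpha> + x0"
    using assms(1,2) p b unfolding eq greaterThanLessThan_iff by linarith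
  show "\<bar>mesh_profile \<alpha> h x - mesh_profile \<alpha> 0 x\<bar> \<le> \<bar>h\<bar>"
    using b unfolding eq mesh_profile_0 by linarith
qed

lemma mesh_profile_bdd_meas: "bdd_meas x0 (mesh_profile \<alpha> h)"
proof -
  have "bdd_meas x0 (\<lambda>x. (1 / \<alpha> + x / 2)
      + h / 2 * (frac (x / h) * (1 + (-1) * frac (x / h))))"
    by (intro bdd_meas_add bdd_meas_mult bdd_meas_frac bdd_meas_const)
      (intro bdd_meas_continuous continuous_intros, simp)
  then show ?thesis by (simp add: mesh_profile_def[abs_def])
qed

lemma continuous_profiles:
  "continuous_on UNIV (source_profile x0 \<alpha>)" "continuous_on UNIV (state_offset q c \<alpha>)"
  "continuous_on UNIV (mesh_profile \<alpha> 0)"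
  unfolding source_profile_def[abs_def] state_offset_def[abs_def] mesh_profile_0
  by (intro continuous_intros; simp)+

section \<open>The limiting error profile does not vanish\<close>

lemma strip_ip_polynomial:
  assumes "0 < x0" "continuous_on UNIV f" "continuous_on UNIV k"
    and "\<And>x. (F has_real_derivative f x * k x) (at x)"
  shows "strip_ip x0 f k = F x0 - F 0"
proof -
  have "((\<lambda>x. f x * k x) has_integral F x0 - F 0) {0..x0}"
    using assms by (intro fundamental_theorem_of_calculus)
      (auto simp: has_real_derivative_iff_has_vector_derivative[symmetric]
        intro: has_field_derivative_at_within)
  moreover have "bdd_meas x0 (\<lambda>x. f x * k x)"
    by (intro bdd_meas_mult bdd_meas_continuous assms)
  ultimately show ?thesis
    using strip_integral_eq_integral by (simp add: strip_ip_def integral_unique)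
qed

text \<open>With \<open>a = 1 / \<alpha>\<close> and \<open>p\<close> the value of the offset at \<open>0\<close>, the two orthogonality
  relations are, up to powers of \<open>x0\<close>, the equations \<open>p * (x0 / 3 + a) = q * x0 * (5 * x0 / 24 + a / 2)\<close>
  and \<open>p * (x0 / 4 + a) = q * x0 * (x0 / 6 + a / 2)\<close>. Eliminating \<open>p\<close>, all terms with \<open>a\<close>
  cancel, and what remains is \<open>q\<close> times \<open>1/18 - 5/96 = 1/288\<close> and a power of \<open>x0\<close>.\<close>
lemma offset_not_orthogonal:
  assumes "x0 > 0" "q \<noteq> 0"
  shows "\<not> (strip_ip x0 (source_profile x0 \<alpha>) (state_offset q c \<alpha>) = 0
    \<and> strip_ip x0 (mesh_profile \<alpha> 0) (state_offset q c \<alpha>) = 0)"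
proof
  define p a where "p = c - q / \<alpha>" and "a = 1 / \<alpha>"
  assume orth: "strip_ip x0 (source_profile x0 \<alpha>) (state_offset q c \<alpha>) = 0
    \<and> strip_ip x0 (mesh_profile \<alpha> 0) (state_offset q c \<alpha>) = 0"
  have profiles: "source_profile x0 \<alpha> x = - x\<^sup>2 / 2 + x0 * x + x0 * a"
    "mesh_profile \<alpha> 0 x = a + x / 2" "state_offset q c \<alpha> x = p - q * x" for x
    by (simp_all add: source_profile_def mesh_profile_0 state_offset_def a_def p_def)
  have "strip_ip x0 (source_profile x0 \<alpha>) (state_offset q c \<alpha>)
    = (\<lambda>x. p * (- (x^3) / 6 + x0 * x\<^sup>2 / 2 + x0 * a * x)
        - q * (- (x^4) / 8 + x0 * x^3 / 3 + x0 * a * x\<^sup>2 / 2)) x0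
    - (\<lambda>x. p * (- (x^3) / 6 + x0 * x\<^sup>2 / 2 + x0 * a * x)
        - q * (- (x^4) / 8 + x0 * x^3 / 3 + x0 * a * x\<^sup>2 / 2)) 0"
    by (intro strip_ip_polynomial assms continuous_profiles)
      (auto intro!: derivative_eq_intros
        simp: profiles field_simps power2_eq_square power3_eq_cube)
  then have 1: "p * (x0^3 / 3 + x0\<^sup>2 * a) = q * (5 * x0^4 / 24 + x0^3 * a / 2)"
    using orth by (simp add: algebra_simps power2_eq_square power3_eq_cube power4_eq_xxxx)
  have "strip_ip x0 (mesh_profile \<alpha> 0) (state_offset q c \<alpha>)
    = (\<lambda>x. p * (a * x + x\<^sup>2 / 4) - q * (a * x\<^sup>2 / 2 + x^3 / 6)) x0
    - (\<lambda>x. p * (a * x + x\<^sup>2 / 4) - q * (a * x\<^sup>2 / 2 + x^3 / 6)) 0"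
    by (intro strip_ip_polynomial assms continuous_profiles)
      (auto intro!: derivative_eq_intros
        simp: profiles field_simps power2_eq_square)
  then have 2: "p * (a * x0 + x0\<^sup>2 / 4) = q * (a * x0\<^sup>2 / 2 + x0^3 / 6)"
    using orth by simp
  have "p * (x0^3 / 3 + x0\<^sup>2 * a) * (a * x0 + x0\<^sup>2 / 4)
      - p * (a * x0 + x0\<^sup>2 / 4) * (x0^3 / 3 + x0\<^sup>2 * a) = - q * x0 ^ 6 / 288"
    unfolding 1 2 by (simp add: field_simps power_numeral_reduce)
  then show False using assms by simp
qed

text \<open>The two profiles are linearly independent: the second difference at \<open>0\<close>, \<open>x0 / 2\<close>,
  \<open>x0\<close> annihilates the linear one but not the quadratic one.\<close>
lemma error_profile_pos:
  assumes "x0 > 0" "\<delta> \<noteq> 0 \<or> g \<noteq> 0"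
  shows "strip_ip x0 (\<lambda>x. \<delta> * source_profile x0 \<alpha> x + g * mesh_profile \<alpha> 0 x)
    (\<lambda>x. \<delta> * source_profile x0 \<alpha> x + g * mesh_profile \<alpha> 0 x) > 0"
proof (rule ccontr)
  define P where "P x = \<delta> * source_profile x0 \<alpha> x + g * mesh_profile \<alpha> 0 x" for x
  assume "\<not> ?thesis"
  then have "strip_ip x0 P P = 0"
    using strip_ip_nonneg[of x0 P] by (simp add: P_def[abs_def])
  moreover have "continuous_on UNIV P"
    unfolding P_def[abs_def] by (intro continuous_intros continuous_profiles)
  ultimately have z: "P x = 0" if "x \<in> {0..x0}" for x
    using strip_ip_eq_0D assms(1) that by blast
  have "P 0 - 2 * P (x0 / 2) + P x0 = - \<delta> * x0\<^sup>2 / 4"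
    by (simp add: P_def source_profile_def mesh_profile_0 algebra_simps power2_eq_square
        add_divide_distrib)
  then have d: "\<delta> = 0" using z[of 0] z[of x0] z[of "x0 / 2"] assms(1) by simp
  have "P x0 - P 0 = g * x0 / 2"
    by (simp add: P_def d mesh_profile_0 algebra_simps)
  then have "g = 0" using z[of 0] z[of x0] assms(1) by simp
  with d assms(2) show False by simp
qed

section \<open>The mean square of a linear function plus a sawtooth\<close>

text \<open>Integration over the first \<open>m\<close> cells, by adding one cell at a time. The integral over a
  single cell is elementary because \<open>frac (x / h)\<close> is linear there, apart from its right end
  point.\<close>
lemma sawtooth_integral_partial:
  assumes "h > 0"
  shows "((\<lambda>x. (a * (x0 - x) + c * (1 - frac (x / h)))\<^sup>2) has_integral
      a\<^sup>2 * (x0^3 - (x0 - real m * h)^3) / 3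
      + 2 * a * c * (x0 * real m * h / 2 - h\<^sup>2 * real m * (real m - 1) / 4 - real m * h\<^sup>2 / 6)
      + c\<^sup>2 * real m * h / 3) {0..real m * h}"
proof (induction m)
  case 0
  show ?case using has_integral_null_real[of 0 0] by simp
next
  case (Suc m)
  define k where "k = real m"
  \<comment> \<open>An antiderivative on the cell, grouped by the coefficients \<open>a\<^sup>2\<close>, \<open>2 * a * c\<close> and
    \<open>c\<^sup>2\<close> of the expanded square.\<close>
  define F where "F x = - a\<^sup>2 * (x0 - x)^3 / 3
    + 2 * a * c * (x0 * (k + 1) * x - (k + 1) * x\<^sup>2 / 2 - x0 * x\<^sup>2 / (2 * h) + x^3 / (3 * h))
    + c\<^sup>2 * ((k + 1)\<^sup>2 * x - (k + 1) * x\<^sup>2 / h + x^3 / (3 * h\<^sup>2))" for x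
  have "((\<lambda>x. (a * (x0 - x) + c * (k + 1 - x / h))\<^sup>2) has_integral
      F ((k + 1) * h) - F (k * h)) {k * h..(k + 1) * h}"
  proof (rule fundamental_theorem_of_calculus)
    show "k * h \<le> (k + 1) * h" using assms by (simp add: algebra_simps)
    fix x
    have "(F has_real_derivative (a * (x0 - x) + c * (k + 1 - x / h))\<^sup>2) (at x)"
      unfolding F_def using assms
      by (auto intro!: derivative_eq_intros simp: field_simps power2_eq_square)
    then show "(F has_vector_derivative (a * (x0 - x) + c * (k + 1 - x / h))\<^sup>2)
        (at x within {k * h..(k + 1) * h})"
      by (simp add: has_real_derivative_iff_has_vector_derivative[symmetric]
          has_field_derivative_at_within)
  qed
  then have "((\<lambda>x. (a * (x0 - x) + c * (1 - frac (x / h)))\<^sup>2) has_integral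
      F ((k + 1) * h) - F (k * h)) {k * h..(k + 1) * h}"
  proof (rule has_integral_spike_finite[of "{(k + 1) * h}", rotated 2])
    fix x assume "x \<in> {k * h..(k + 1) * h} - {(k + 1) * h}"
    then have "k \<le> x / h" "x / h < k + 1" using assms by (auto simp: field_simps)
    then have "\<lfloor>x / h\<rfloor> = int m" unfolding k_def by linarith
    then show "(a * (x0 - x) + c * (1 - frac (x / h)))\<^sup>2
        = (a * (x0 - x) + c * (k + 1 - x / h))\<^sup>2"
      by (simp add: frac_def k_def algebra_simps)
  qed simp
  moreover have "F ((k + 1) * h) - F (k * h)
    = a\<^sup>2 * ((x0 - k * h)^3 - (x0 - (k + 1) * h)^3) / 3
      + 2 * a * c * (x0 * h / 2 - k * h\<^sup>2 / 2 - h\<^sup>2 / 6) + c\<^sup>2 * h / 3"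
    unfolding F_def using assms by (simp add: field_simps power2_eq_square power3_eq_cube)
  ultimately have "((\<lambda>x. (a * (x0 - x) + c * (1 - frac (x / h)))\<^sup>2) has_integral
      a\<^sup>2 * ((x0 - k * h)^3 - (x0 - (k + 1) * h)^3) / 3
      + 2 * a * c * (x0 * h / 2 - k * h\<^sup>2 / 2 - h\<^sup>2 / 6) + c\<^sup>2 * h / 3) {k * h..(k + 1) * h}"
    by simp
  then have "((\<lambda>x. (a * (x0 - x) + c * (1 - frac (x / h)))\<^sup>2) has_integral
      (a\<^sup>2 * (x0^3 - (x0 - k * h)^3) / 3
      + 2 * a * c * (x0 * k * h / 2 - h\<^sup>2 * k * (k - 1) / 4 - k * h\<^sup>2 / 6) + c\<^sup>2 * k * h / 3)
      + (a\<^sup>2 * ((x0 - k * h)^3 - (x0 - (k + 1) * h)^3) / 3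
      + 2 * a * c * (x0 * h / 2 - k * h\<^sup>2 / 2 - h\<^sup>2 / 6) + c\<^sup>2 * h / 3)) {0..(k + 1) * h}"
    using assms Suc.IH[folded k_def]
    by - (rule has_integral_combine[where c = "k * h"], simp_all add: k_def)
  moreover have "(a\<^sup>2 * (x0^3 - (x0 - k * h)^3) / 3
      + 2 * a * c * (x0 * k * h / 2 - h\<^sup>2 * k * (k - 1) / 4 - k * h\<^sup>2 / 6) + c\<^sup>2 * k * h / 3)
      + (a\<^sup>2 * ((x0 - k * h)^3 - (x0 - (k + 1) * h)^3) / 3
      + 2 * a * c * (x0 * h / 2 - k * h\<^sup>2 / 2 - h\<^sup>2 / 6) + c\<^sup>2 * h / 3)
    = a\<^sup>2 * (x0^3 - (x0 - (k + 1) * h)^3) / 3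
      + 2 * a * c * (x0 * (k + 1) * h / 2 - h\<^sup>2 * (k + 1) * (k + 1 - 1) / 4 - (k + 1) * h\<^sup>2 / 6)
      + c\<^sup>2 * (k + 1) * h / 3"
    by (simp add: field_simps)
  moreover have "real (Suc m) = k + 1" by (simp add: k_def)
  ultimately show ?case by (simp only:)
qed

text \<open>The oscillating sawtooth acts like its mean \<open>1/2\<close> in the mixed term, with an error of
  order \<open>h\<close>, whereas its square has mean \<open>1/3\<close> exactly.\<close>
lemma sawtooth_strip_ip:
  assumes "x0 > 0" "n > 0" and h: "h = x0 / real n"
  shows "strip_ip x0 (\<lambda>x. a * (x0 - x) + c * (1 - frac (x / h)))
      (\<lambda>x. a * (x0 - x) + c * (1 - frac (x / h)))
    = a\<^sup>2 * x0^3 / 3 + a * c * (x0\<^sup>2 / 2 + x0 * h / 6) + c\<^sup>2 * x0 / 3"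
proof -
  define W where "W x = a * (x0 - x) + c * (1 - frac (x / h))" for x
  have nh: "real n * h = x0" and hp: "h > 0" using assms by auto
  have n: "real n = x0 / h" using nh hp by (simp add: field_simps)
  have eq: "a\<^sup>2 * (x0^3 - (x0 - x0)^3) / 3
      + 2 * a * c * (x0 * real n * h / 2 - h\<^sup>2 * real n * (real n - 1) / 4 - real n * h\<^sup>2 / 6)
      + c\<^sup>2 * real n * h / 3 = a\<^sup>2 * x0^3 / 3 + a * c * (x0\<^sup>2 / 2 + x0 * h / 6) + c\<^sup>2 * x0 / 3"
    unfolding n using hp by (simp add: field_simps power2_eq_square)
  have "((\<lambda>x. (W x)\<^sup>2) has_integral
      a\<^sup>2 * x0^3 / 3 + a * c * (x0\<^sup>2 / 2 + x0 * h / 6) + c\<^sup>2 * x0 / 3) {0..x0}"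
    using sawtooth_integral_partial[OF hp, of a x0 c n, unfolded nh]
    unfolding eq W_def .
  moreover have "bdd_meas x0 W"
  proof -
    have "bdd_meas x0 (\<lambda>x. a * (x0 - x) + c * (1 + (-1) * frac (x / h)))"
      by (intro bdd_meas_add bdd_meas_mult bdd_meas_frac bdd_meas_const)
        (intro bdd_meas_continuous continuous_intros)
    then show ?thesis by (simp add: W_def[abs_def])
  qed
  then have "strip_ip x0 W W = integral {0..x0} (\<lambda>x. (W x)\<^sup>2)"
    unfolding strip_ip_def power2_eq_square by (intro strip_integral_eq_integral bdd_meas_mult)
  ultimately have "strip_ip x0 W W
      = a\<^sup>2 * x0^3 / 3 + a * c * (x0\<^sup>2 / 2 + x0 * h / 6) + c\<^sup>2 * x0 / 3"
    by (simp add: integral_unique)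
  then show ?thesis by (simp add: W_def[abs_def])
qed

section \<open>Closed forms of the errors\<close>

lemma deriv_u_sol: "deriv (\<lambda>s. u_sol x0 q b \<alpha> g (s, y)) x = g * (x0 - x) - q"
  unfolding u_sol_def
  by (rule DERIV_imp_deriv) (auto intro!: derivative_eq_intros simp: algebra_simps)

lemma deriv_u_disc:
  assumes "h > 0" "x / h \<notin> \<int>"
  shows "deriv (\<lambda>s. u_disc x0 q b \<alpha> h g (s, y)) x
    = g * (x0 - x) - q - g * h * (1 - frac (x / h))"
proof -
  define m where "m = \<lfloor>x / h\<rfloor>"
  have "x / h \<noteq> of_int m" using assms(2) by auto
  then have "of_int m < x / h" "x / h < of_int m + 1" unfolding m_def by linarith+
  then have x: "x \<in> {of_int m * h<..<(of_int m + 1) * h}" using assms(1) by (simp add: field_simps)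
  have "\<lfloor>s / h\<rfloor> = m" if "s \<in> {of_int m * h<..<(of_int m + 1) * h}" for s
  proof -
    have "of_int m < s / h" "s / h < of_int m + 1" using that assms(1) by (auto simp: field_simps)
    then show ?thesis by linarith
  qed
  then have "\<forall>\<^sub>F s in nhds x. u_disc x0 q b \<alpha> h g (s, y) = u_cell x0 q b \<alpha> h g (of_int m + 1) s"
    using eventually_nhds_in_open[OF open_greaterThanLessThan x]
    by (auto simp: u_disc_def elim: eventually_mono)
  then have "deriv (\<lambda>s. u_disc x0 q b \<alpha> h g (s, y)) x
      = deriv (\<lambda>s. u_cell x0 q b \<alpha> h g (of_int m + 1) s) x"
    by (rule deriv_cong_ev) simp
  also have "\<dots> = g * x0 - q - h * g * (of_int m + 1)"
    unfolding u_cell_def by (rule DERIV_imp_deriv) (auto intro!: derivative_eq_intros)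
  also have "\<dots> = g * (x0 - x) - q - g * h * (1 - frac (x / h))"
    using assms(1) by (simp add: frac_def m_def field_simps)
  finally show ?thesis .
qed

text \<open>Off the grid the difference of the derivatives is a linear function plus a sawtooth. On the
  countable set of grid points the value of \<open>deriv\<close> is not known, but changing a function on a
  countable set affects neither its measurability nor its integral.\<close>
lemma H_norm_partial_x_error:
  assumes "x0 > 0" "y0 > 0" "n > 0" and h: "h = x0 / real n"
  shows "H_norm x0 y0 (\<lambda>p. partial_x (u_sol x0 q b \<alpha> g) p - partial_x (u_disc x0 q b \<alpha> h g') p)
    = sqrt (y0 * ((g - g')\<^sup>2 * x0^3 / 3 + (g - g') * (g' * h) * (x0\<^sup>2 / 2 + x0 * h / 6)
        + (g' * h)\<^sup>2 * x0 / 3))"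
proof -
  have hp: "h > 0" using assms by simp
  define k where "k x = deriv (\<lambda>s. u_sol x0 q b \<alpha> g (s, 0)) x
    - deriv (\<lambda>s. u_disc x0 q b \<alpha> h g' (s, 0)) x" for x
  define W where "W x = (g - g') * (x0 - x) + (g' * h) * (1 - frac (x / h))" for x
  \<comment> \<open>The grid, extended to the whole real line.\<close>
  define X where "X = (\<lambda>i. of_int i * h) ` UNIV"
  have "x / h \<notin> \<int>" if "x \<notin> X" for x
  proof
    assume "x / h \<in> \<int>"
    then obtain i where "x / h = of_int i" by (elim Ints_cases)
    then have "x = of_int i * h" using hp by (simp add: field_simps)
    then show False using that by (auto simp: X_def)
  qed
  then have kW: "W x = k x" if "x \<notin> X" for x
    using that hp unfolding k_def W_def by (simp add: deriv_u_sol deriv_u_disc algebra_simps)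
  have cX: "countable X" by (simp add: X_def)
  have [measurable]: "W \<in> borel_measurable borel" unfolding W_def[abs_def] frac_def by measurable
  have [measurable]: "k \<in> borel_measurable borel"
    by (rule measurable_discrete_difference[of W _ _ X]) (auto simp: cX kW)
  have ae: "AE x in lborel. k x = W x"
    using AE_not_in[OF countable_imp_null_set_lborel[OF cX]] by eventually_elim (simp add: kW)
  have "(\<lambda>p. partial_x (u_sol x0 q b \<alpha> g) p - partial_x (u_disc x0 q b \<alpha> h g') p)
      = (\<lambda>p. k (fst p))"
    by (simp add: partial_x_def k_def fun_eq_iff u_sol_def u_disc_def)
  moreover have "H_norm x0 y0 (\<lambda>p. k (fst p)) = sqrt (y0 * strip_ip x0 k k)"
    by (rule H_norm_of_x) (use assms in auto)
  moreover have "strip_ip x0 k k = strip_ip x0 W W"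
    unfolding strip_ip_def using ae by (intro set_lebesgue_integral_cong_AE) auto
  ultimately show ?thesis
    using sawtooth_strip_ip[OF assms(1,3) h, of "g - g'" "g' * h"] by (simp add: W_def[abs_def])
qed

lemma H_norm_error:
  assumes "y0 > 0" "h \<noteq> 0"
  shows "H_norm x0 y0 (\<lambda>p. u_sol x0 q b \<alpha> g p - u_disc x0 q b \<alpha> h g' p)
    = sqrt (y0 * ((g - g')\<^sup>2 * strip_ip x0 (source_profile x0 \<alpha>) (source_profile x0 \<alpha>)
        + 2 * (g - g') * (g' * h) * strip_ip x0 (source_profile x0 \<alpha>) (mesh_profile \<alpha> h)
        + (g' * h)\<^sup>2 * strip_ip x0 (mesh_profile \<alpha> h) (mesh_profile \<alpha> h)))"
proof -
  define k where "k x = (g - g') * source_profile x0 \<alpha> x + (g' * h) * mesh_profile \<alpha> h x" for x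
  note b = bdd_meas_continuous[OF continuous_profiles(1)] mesh_profile_bdd_meas
  have "(\<lambda>p. u_sol x0 q b \<alpha> g p - u_disc x0 q b \<alpha> h g' p) = (\<lambda>p. k (fst p))"
    using assms(2) by (simp add: u_sol_affine u_disc_affine k_def fun_eq_iff algebra_simps)
  moreover have "bdd_meas x0 k"
    unfolding k_def[abs_def] by (intro bdd_meas_add bdd_meas_mult bdd_meas_const b)
  then have "k \<in> borel_measurable borel" by (simp add: bdd_meas_def)
  ultimately show ?thesis
    using H_norm_of_x[of k y0 x0] strip_ip_square[OF b, where a = "g - g'" and c = "g' * h"] assms
    by (simp add: k_def[abs_def])
qed

section \<open>First-order expansion\<close>

lemma g_op_formula:
  assumes "x0 > 0" "y0 > 0" "M1 > 0"
  shows "g_op x0 y0 q b zd M1 \<alpha>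
    = - strip_ip x0 (source_profile x0 \<alpha>) (state_offset q (b - zd) \<alpha>)
      / (strip_ip x0 (source_profile x0 \<alpha>) (source_profile x0 \<alpha>) + M1 * x0)"
proof -
  have "J_cost x0 y0 q b zd M1 \<alpha> = (\<lambda>g. 1 / 2 * (H_norm x0 y0 (\<lambda>p.
      g * source_profile x0 \<alpha> (fst p) + state_offset q (b - zd) \<alpha> (fst p)))\<^sup>2
      + M1 / 2 * (H_norm x0 y0 (\<lambda>p. g))\<^sup>2)"
    by (simp add: J_cost_def fun_eq_iff u_sol_affine state_offset_def algebra_simps)
  then show ?thesis
    unfolding g_op_def
    by (simp only:) (intro arg_min_affine_state assms bdd_meas_continuous continuous_profiles)
qed

lemma g_disc_op_formula:
  fixes x0 \<alpha> h q b zd :: real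
  assumes "x0 > 0" "y0 > 0" "M1 > 0" "h \<noteq> 0"
  defines "\<phi> \<equiv> source_profile x0 \<alpha>" and "\<kappa> \<equiv> mesh_profile \<alpha> h"
    and "\<psi> \<equiv> state_offset q (b - zd) \<alpha>"
  shows "g_disc_op x0 y0 q b zd M1 \<alpha> h
    = - (strip_ip x0 \<phi> \<psi> - h * strip_ip x0 \<kappa> \<psi>)
      / (strip_ip x0 \<phi> \<phi> + M1 * x0 - 2 * h * strip_ip x0 \<phi> \<kappa> + h\<^sup>2 * strip_ip x0 \<kappa> \<kappa>)"
proof -
  define \<phi>h where "\<phi>h x = 1 * \<phi> x + (- h) * \<kappa> x" for x
  have b: "bdd_meas x0 \<phi>" "bdd_meas x0 \<psi>" "bdd_meas x0 \<kappa>"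
    unfolding \<phi>_def \<psi>_def \<kappa>_def
    by (intro bdd_meas_continuous continuous_profiles mesh_profile_bdd_meas)+
  have bh: "bdd_meas x0 \<phi>h"
    unfolding \<phi>h_def[abs_def] by (intro bdd_meas_add bdd_meas_mult bdd_meas_const b)
  have "J_disc x0 y0 q b zd M1 \<alpha> h = (\<lambda>g. 1 / 2 * (H_norm x0 y0 (\<lambda>p.
      g * \<phi>h (fst p) + \<psi> (fst p)))\<^sup>2 + M1 / 2 * (H_norm x0 y0 (\<lambda>p. g))\<^sup>2)"
    using assms(4) unfolding \<phi>h_def \<phi>_def \<kappa>_def \<psi>_def
    by (simp add: J_disc_def fun_eq_iff u_disc_affine state_offset_def algebra_simps)
  then have "g_disc_op x0 y0 q b zd M1 \<alpha> h
      = - strip_ip x0 \<phi>h \<psi> / (strip_ip x0 \<phi>h \<phi>h + M1 * x0)"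
    unfolding g_disc_op_def by (simp only:) (intro arg_min_affine_state assms b bh)
  moreover have "strip_ip x0 \<phi>h \<psi> = strip_ip x0 \<phi> \<psi> - h * strip_ip x0 \<kappa> \<psi>"
    unfolding \<phi>h_def[abs_def] strip_ip_linear[OF b(1,3,2)] by simp
  moreover have "strip_ip x0 \<phi>h \<phi>h = strip_ip x0 \<phi> \<phi> - 2 * h * strip_ip x0 \<phi> \<kappa>
      + h\<^sup>2 * strip_ip x0 \<kappa> \<kappa>"
    unfolding \<phi>h_def[abs_def] strip_ip_square[OF b(1,3)] by simp
  ultimately show ?thesis by (simp add: algebra_simps)
qed

lemma mesh_profile_moments_tendsto:
  fixes x0 \<alpha> :: real and h :: "nat \<Rightarrow> real"
  assumes "\<alpha> > 0" "h \<longlonglongrightarrow> 0" "\<And>n. \<bar>h n\<bar> \<le> x0"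
  shows "continuous_on UNIV f \<Longrightarrow>
      (\<lambda>n. strip_ip x0 (mesh_profile \<alpha> (h n)) f) \<longlonglongrightarrow> strip_ip x0 (mesh_profile \<alpha> 0) f"
    and "(\<lambda>n. strip_ip x0 (mesh_profile \<alpha> (h n)) (mesh_profile \<alpha> (h n)))
      \<longlonglongrightarrow> strip_ip x0 (mesh_profile \<alpha> 0) (mesh_profile \<alpha> 0)"
proof -
  have lim: "(\<lambda>n. mesh_profile \<alpha> (h n) x) \<longlonglongrightarrow> mesh_profile \<alpha> 0 x" if "x \<in> {0<..<x0}" for x
  proof (rule LIM_zero_cancel, rule Lim_null_comparison[of _ "\<lambda>n. \<bar>h n\<bar>"])
    show "\<forall>\<^sub>F n in sequentially. norm (mesh_profile \<alpha> (h n) x - mesh_profile \<alpha> 0 x) \<le> \<bar>h n\<bar>"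
      using mesh_profile_bound(2)[OF that] assms by (intro always_eventually) simp
    show "(\<lambda>n. \<bar>h n\<bar>) \<longlonglongrightarrow> 0" using assms(2) by (rule tendsto_rabs_zero)
  qed
  have bound: "\<bar>mesh_profile \<alpha> (h n) x\<bar> \<le> 1 / \<alpha> + x0" if "x \<in> {0<..<x0}" for n x
    using mesh_profile_bound(1)[OF that] assms by simp
  have m: "mesh_profile \<alpha> t \<in> borel_measurable borel" for t
    using mesh_profile_bdd_meas[of 1 \<alpha> t] by (simp add: bdd_meas_def)
  show "(\<lambda>n. strip_ip x0 (mesh_profile \<alpha> (h n)) f) \<longlonglongrightarrow> strip_ip x0 (mesh_profile \<alpha> 0) f"
    if f: "continuous_on UNIV f"
  proof -
    have fm: "f \<in> borel_measurable borel" and "bdd_meas x0 f"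
      using bdd_meas_continuous[OF f] by (simp_all add: bdd_meas_def)
    then obtain B where B: "\<And>x. x \<in> {0<..<x0} \<Longrightarrow> \<bar>f x\<bar> \<le> B"
      unfolding bdd_meas_def by blast
    show ?thesis by (rule strip_ip_tendsto[OF m fm m fm bound B lim tendsto_const])
  qed
  show "(\<lambda>n. strip_ip x0 (mesh_profile \<alpha> (h n)) (mesh_profile \<alpha> (h n)))
      \<longlonglongrightarrow> strip_ip x0 (mesh_profile \<alpha> 0) (mesh_profile \<alpha> 0)"
    by (rule strip_ip_tendsto[OF m m m m bound bound lim lim])
qed

text \<open>Since \<open>h\<close> is positive, it can be taken out of the root; what is left converges because
  the square root is continuous. It is used with \<open>Q\<close> a quadratic form in the scaled control
  error and the discrete optimal control.\<close>
lemma sqrt_first_order: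
  fixes h E :: "nat \<Rightarrow> real"
  assumes "y0 > 0" and h: "\<forall>\<^sub>F n in sequentially. h n > 0"
    and l: "Q \<longlonglongrightarrow> L"
    and E: "\<forall>\<^sub>F n in sequentially. E n = sqrt (y0 * ((h n)\<^sup>2 * Q n))"
  shows "(\<lambda>n. E n - sqrt (y0 * L) * h n) \<in> o[sequentially](h)"
proof (rule smalloI_tendsto)
  have "(\<lambda>n. sqrt (y0 * Q n) - sqrt (y0 * L)) \<longlonglongrightarrow> sqrt (y0 * L) - sqrt (y0 * L)"
    by (intro tendsto_intros l)
  moreover have "\<forall>\<^sub>F n in sequentially. sqrt (y0 * Q n) - sqrt (y0 * L)
      = (E n - sqrt (y0 * L) * h n) / h n"
    using h E
  proof eventually_elim
    case (elim n)
    then have "E n = sqrt (y0 * Q n) * h n"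
      by (simp add: real_sqrt_mult mult_ac)
    then show ?case using elim by (simp add: field_simps)
  qed
  ultimately show "(\<lambda>n. (E n - sqrt (y0 * L) * h n) / h n) \<longlonglongrightarrow> 0"
    by (simp add: filterlim_cong)
  show "\<forall>\<^sub>F n in sequentially. h n \<noteq> 0" using h by eventually_elim simp
qed

theorem lemma8:
  fixes x0 y0 q b zd M1 \<alpha> :: real
  assumes "x0 > 0" and "y0 > 0" and "q \<noteq> 0" and "M1 > 0" and "\<alpha> > 0"
  shows "let h = (\<lambda>n::nat. x0 / real n);
             u = u_sol x0 q b \<alpha> (g_op x0 y0 q b zd M1 \<alpha>);
             uh = (\<lambda>n. u_disc x0 q b \<alpha> (h n) (g_disc_op x0 y0 q b zd M1 \<alpha> (h n)))
         in \<exists>C5 C6. C5 > 0 \<and> C6 > 0 \<and>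
              (\<lambda>n. H_norm x0 y0 (\<lambda>p. u p - uh n p) - C5 * h n) \<in> o[sequentially](h) \<and>
              (\<lambda>n. H_norm x0 y0 (\<lambda>p. partial_x u p - partial_x (uh n) p) - C6 * h n)
                \<in> o[sequentially](h)"
proof -
  define h where "h = (\<lambda>n::nat. x0 / real n)"
  define \<phi> \<psi> \<kappa> where "\<phi> = source_profile x0 \<alpha>" and "\<psi> = state_offset q (b - zd) \<alpha>"
    and "\<kappa> = mesh_profile \<alpha>"
  define N D where "N = strip_ip x0 \<phi> \<psi>" and "D = strip_ip x0 \<phi> \<phi> + M1 * x0"
  define g where "g = g_op x0 y0 q b zd M1 \<alpha>"
  define gn where "gn n = g_disc_op x0 y0 q b zd M1 \<alpha> (h n)" for n
  define d where "d n = (g - gn n) / h n" for n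
  define \<delta> where "\<delta> = (2 * N * strip_ip x0 \<phi> (\<kappa> 0) - strip_ip x0 (\<kappa> 0) \<psi> * D) / D\<^sup>2"
  note cont = continuous_profiles(1)[of x0 \<alpha>, folded \<phi>_def]
    continuous_profiles(2)[of q "b - zd" \<alpha>, folded \<psi>_def]
  have h0: "h \<longlonglongrightarrow> 0"
    unfolding h_def by (rule lim_const_over_n)
  have hpos: "\<forall>\<^sub>F n in sequentially. h n > 0"
    using eventually_gt_at_top[of 0] by eventually_elim (use assms(1) in \<open>simp add: h_def\<close>)
  then have hne: "\<forall>\<^sub>F n in sequentially. h n \<noteq> 0" by eventually_elim simp
  have hb: "\<bar>h n\<bar> \<le> x0" for n
    using assms(1) by (cases "n = 0") (auto simp: h_def field_simps)
  note lims = mesh_profile_moments_tendsto[OF assms(5) h0 hb, folded \<kappa>_def]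
  have lim\<psi>: "(\<lambda>n. strip_ip x0 (\<kappa> (h n)) \<psi>) \<longlonglongrightarrow> strip_ip x0 (\<kappa> 0) \<psi>"
    and lim\<phi>: "(\<lambda>n. strip_ip x0 \<phi> (\<kappa> (h n))) \<longlonglongrightarrow> strip_ip x0 \<phi> (\<kappa> 0)"
    and lim\<kappa>: "(\<lambda>n. strip_ip x0 (\<kappa> (h n)) (\<kappa> (h n))) \<longlonglongrightarrow> strip_ip x0 (\<kappa> 0) (\<kappa> 0)"
    using lims(1)[OF cont(2)] lims(1)[OF cont(1)] lims(2)
    by (simp_all add: strip_ip_commute[of x0 \<phi>])
  have D: "D > 0"
    using strip_ip_nonneg[of x0 \<phi>] assms by (simp add: D_def add_nonneg_pos)
  have g: "g = - N / D"
    unfolding g_def N_def D_def \<phi>_def \<psi>_def using assms by (intro g_op_formula)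
  have "\<forall>\<^sub>F n in sequentially. gn n = - (N - h n * strip_ip x0 (\<kappa> (h n)) \<psi>)
      / (D - 2 * h n * strip_ip x0 \<phi> (\<kappa> (h n)) + (h n)\<^sup>2 * strip_ip x0 (\<kappa> (h n)) (\<kappa> (h n)))"
    using hne
    by eventually_elim
      (simp add: gn_def N_def D_def \<phi>_def \<psi>_def \<kappa>_def g_disc_op_formula[OF assms(1,2,4)])
  from optimum_expansion[OF D h0 hne lim\<psi> lim\<phi> lim\<kappa> this]
  have d: "d \<longlonglongrightarrow> \<delta>" unfolding d_def[abs_def] \<delta>_def g .
  have gn_eq: "\<forall>\<^sub>F n in sequentially. g - h n * d n = gn n"
    using hne by eventually_elim (simp add: d_def)
  have "(\<lambda>n. g - h n * d n) \<longlonglongrightarrow> g - 0 * \<delta>" by (intro tendsto_intros h0 d)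
  then have gn: "gn \<longlonglongrightarrow> g" using filterlim_cong[OF refl refl gn_eq] by simp
  \<comment> \<open>If \<open>g = 0\<close>, then \<open>N = 0\<close>, and \<open>\<delta>\<close> is a nonzero multiple of the inner product of
    \<open>\<kappa> 0\<close> and \<open>\<psi>\<close>.\<close>
  have nz: "\<delta> \<noteq> 0 \<or> g \<noteq> 0"
  proof (rule ccontr)
    assume "\<not> ?thesis"
    then have "N = 0" "strip_ip x0 (\<kappa> 0) \<psi> = 0" using D by (auto simp: g \<delta>_def)
    then show False
      using offset_not_orthogonal[OF assms(1,3)] by (auto simp: N_def \<phi>_def \<psi>_def \<kappa>_def)
  qed

  \<comment> \<open>\<open>Q5\<close> is the squared error of the state divided by \<open>y0 * h\<^sup>2\<close>; its limit \<open>L5\<close> is the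
    squared norm of \<open>\<delta> * \<phi> + g * \<kappa> 0\<close>.\<close>
  define Q5 where "Q5 n = (d n)\<^sup>2 * strip_ip x0 \<phi> \<phi> + 2 * d n * gn n * strip_ip x0 \<phi> (\<kappa> (h n))
    + (gn n)\<^sup>2 * strip_ip x0 (\<kappa> (h n)) (\<kappa> (h n))" for n
  define L5 where "L5 = \<delta>\<^sup>2 * strip_ip x0 \<phi> \<phi> + 2 * \<delta> * g * strip_ip x0 \<phi> (\<kappa> 0)
    + g\<^sup>2 * strip_ip x0 (\<kappa> 0) (\<kappa> 0)"
  have Q5: "Q5 \<longlonglongrightarrow> L5"
    unfolding Q5_def[abs_def] L5_def by (intro tendsto_intros d gn lim\<phi> lim\<kappa>)
  have L5: "L5 > 0"
    using error_profile_pos[OF assms(1) nz, of \<alpha>]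
    unfolding L5_def \<phi>_def \<kappa>_def
    by (subst (asm) strip_ip_square) (auto intro: bdd_meas_continuous continuous_profiles)
  have E5: "\<forall>\<^sub>F n in sequentially.
      H_norm x0 y0 (\<lambda>p. u_sol x0 q b \<alpha> g p - u_disc x0 q b \<alpha> (h n) (gn n) p)
      = sqrt (y0 * ((h n)\<^sup>2 * Q5 n))"
    using hne
  proof eventually_elim
    case (elim n)
    then have "g - gn n = h n * d n" by (simp add: d_def)
    then show ?case
      by (simp add: H_norm_error[OF assms(2) elim] Q5_def \<phi>_def \<kappa>_def algebra_simps
          power2_eq_square)
  qed

  \<comment> \<open>\<open>Q6\<close> is the squared error of the derivative divided by \<open>y0 * h\<^sup>2\<close>.\<close>
  define Q6 where "Q6 n = (d n)\<^sup>2 * x0^3 / 3 + d n * gn n * (x0\<^sup>2 / 2 + x0 * h n / 6)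
    + (gn n)\<^sup>2 * x0 / 3" for n
  define L6 where "L6 = \<delta>\<^sup>2 * x0^3 / 3 + \<delta> * g * (x0\<^sup>2 / 2 + x0 * 0 / 6) + g\<^sup>2 * x0 / 3"
  have Q6: "Q6 \<longlonglongrightarrow> L6"
    unfolding Q6_def[abs_def] L6_def by (intro tendsto_intros d gn h0) simp_all
  \<comment> \<open>Splitting the mean square \<open>1/3\<close> of the sawtooth into its squared mean \<open>1/4\<close> and its
    variance \<open>1/12\<close>, and likewise for the linear part.\<close>
  have "L6 = x0 * ((\<delta> * x0 / 2 + g / 2)\<^sup>2 + (\<delta> * x0)\<^sup>2 / 12 + g\<^sup>2 / 12)"
    by (simp add: L6_def field_simps power2_eq_square power3_eq_cube)
  moreover have "(\<delta> * x0)\<^sup>2 / 12 + g\<^sup>2 / 12 > 0"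
    using nz assms(1) by (auto intro: add_pos_nonneg add_nonneg_pos)
  ultimately have L6: "L6 > 0"
    using assms(1) by (simp add: add_nonneg_pos add.assoc)
  have E6: "\<forall>\<^sub>F n in sequentially.
      H_norm x0 y0 (\<lambda>p. partial_x (u_sol x0 q b \<alpha> g) p
        - partial_x (u_disc x0 q b \<alpha> (h n) (gn n)) p)
      = sqrt (y0 * ((h n)\<^sup>2 * Q6 n))"
    using eventually_gt_at_top[of 0] hne
  proof eventually_elim
    case (elim n)
    then have "g - gn n = h n * d n" by (simp add: d_def)
    then show ?case
      by (simp add: H_norm_partial_x_error[OF assms(1,2) elim(1) h_def[THEN fun_cong]] Q6_def
          algebra_simps power2_eq_square)
  qed

  have "sqrt (y0 * L5) > 0" "sqrt (y0 * L6) > 0" using assms(2) L5 L6 by simp_all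
  with sqrt_first_order[OF assms(2) hpos Q5 E5] sqrt_first_order[OF assms(2) hpos Q6 E6]
  show ?thesis
    unfolding Let_def h_def[symmetric] g_def[symmetric] fun_cong[OF h_def, symmetric]
      gn_def[symmetric] by blast
qed

end
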